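(* Let $(X,\tau,\mathcal{I})$ be an ideal topological space. Then the function $cl^\sharp:2^X\to 2^X$ defined by $cl^\sharp(A)=A\cup A^\sharp$ for every $A\subseteq X$ is a Kuratowski closure operator.
   Context: An ideal on a set $X$ is a non-empty family $\mathcal{I}\subseteq 2^X$ ($2^X$ is the power set of $X$) closed under taking subsets and finite unions. An ideal topological space $(X,\tau,\mathcal{I})$ is a topological space $(X,\tau)$ together with an ideal $\mathcal{I}$ on $X$. $\tau(x)$ denotes the collection of all open sets containing $x$, and $S^c=X\setminus S$. For $A\subseteq X$, the sharp function is $A^\sharp=A^\sharp(\mathcal{I},\tau)=\{x\in X\mid(\forall U\in\tau(x))(\exists I\in\mathcal{I}\setminus\{\emptyset\})(I\cap(U\cap A)^c=\emptyset)\}$. *)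

theory Defs
  imports "HOL-Analysis.Analysis"
begin

definition ideal_on :: "'a set \<Rightarrow> 'a set set \<Rightarrow> bool" where
  "ideal_on X \<I> \<longleftrightarrow>
     \<I> \<noteq> {} \<and> \<I> \<subseteq> Pow X \<and>
     (\<forall>A B. A \<in> \<I> \<longrightarrow> B \<subseteq> A \<longrightarrow> B \<in> \<I>) \<and>
     (\<forall>A B. A \<in> \<I> \<longrightarrow> B \<in> \<I> \<longrightarrow> A \<union> B \<in> \<I>)"

(* The pair (X, tau) is a single value \<T> :: 'a topology with X = topspace \<T>. *)
definition ideal_topological_space :: "'a topology \<Rightarrow> 'a set set \<Rightarrow> bool" where
  "ideal_topological_space \<T> \<I> \<longleftrightarrow> ideal_on (topspace \<T>) \<I>"

(* Complements are relative to the carrier X = topspace \<T>, not to UNIV. *)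
definition sharp :: "'a topology \<Rightarrow> 'a set set \<Rightarrow> 'a set \<Rightarrow> 'a set" where
  "sharp \<T> \<I> A =
     {x \<in> topspace \<T>. \<forall>U. openin \<T> U \<and> x \<in> U \<longrightarrow>
        (\<exists>I \<in> \<I> - {{}}. I \<inter> (topspace \<T> - (U \<inter> A)) = {})}"

definition cl_sharp :: "'a topology \<Rightarrow> 'a set set \<Rightarrow> 'a set \<Rightarrow> 'a set" where
  "cl_sharp \<T> \<I> A = A \<union> sharp \<T> \<I> A"

definition kuratowski_closure_operator :: "'a set \<Rightarrow> ('a set \<Rightarrow> 'a set) \<Rightarrow> bool" where
  "kuratowski_closure_operator X c \<longleftrightarrow>
     c \<in> Pow X \<rightarrow> Pow X \<and>
     c {} = {} \<and>
     (\<forall>A\<subseteq>X. A \<subseteq> c A) \<and>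
     (\<forall>A\<subseteq>X. \<forall>B\<subseteq>X. c (A \<union> B) = c A \<union> c B) \<and>
     (\<forall>A\<subseteq>X. c (c A) = c A)"

end

theory Submission
  imports Defs
begin

text \<open>
  The sharp function is an ordinary closure in disguise. An ideal is closed under taking
  subsets, so a set contains a nonempty member of the ideal iff it contains a point of the
  union \<open>\<Union>\<I>\<close>: a nonempty member yields such a point, and conversely every point of
  \<open>\<Union>\<I>\<close> gives a singleton in the ideal. Hence the sharp of \<open>A\<close> is the closure of
  \<open>A \<inter> \<Union>\<I>\<close> (lemma \<open>sharp_eq_closure_of\<close>), and the operator in question is
  \<open>A \<mapsto> A \<union> cl (A \<inter> K)\<close> with the fixed set \<open>K = \<Union>\<I>\<close>. That this operator satisfies
  the Kuratowski axioms follows from the same axioms for topological closure, whatever the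
  set \<open>K\<close> is (lemma \<open>kuratowski_Un_closure_of_Int\<close>).
\<close>

lemma sharp_eq_closure_of:
  assumes "ideal_on (topspace \<T>) \<I>"
  shows "sharp \<T> \<I> A = \<T> closure_of (A \<inter> \<Union>\<I>)"
proof -
  have in_space: "\<Union>\<I> \<subseteq> topspace \<T>"
    and subset_closed: "\<And>A B. A \<in> \<I> \<Longrightarrow> B \<subseteq> A \<Longrightarrow> B \<in> \<I>"
    using assms by (auto simp: ideal_on_def)
  have nonempty_member_iff:
    "(\<exists>I \<in> \<I> - {{}}. I \<inter> (topspace \<T> - S) = {}) \<longleftrightarrow> S \<inter> \<Union>\<I> \<noteq> {}" for S
  proof
    assume "\<exists>I \<in> \<I> - {{}}. I \<inter> (topspace \<T> - S) = {}"
    then show "S \<inter> \<Union>\<I> \<noteq> {}"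
      using in_space by blast
  next
    assume "S \<inter> \<Union>\<I> \<noteq> {}"
    then obtain y I where "y \<in> S" "y \<in> I" "I \<in> \<I>" by blast
    then have "{y} \<in> \<I> - {{}}"
      using subset_closed[of I "{y}"] by simp
    with \<open>y \<in> S\<close> show "\<exists>I \<in> \<I> - {{}}. I \<inter> (topspace \<T> - S) = {}"
      by blast
  qed
  show ?thesis
    unfolding sharp_def nonempty_member_iff closure_of_def
    by (rule Collect_cong) (metis Int_assoc Int_emptyI Int_iff disjoint_iff)
qed

text \<open>
  Only idempotence is not inherited axiom by axiom: the points that the first application
  adds lie in the closed set \<open>\<T> closure_of (A \<inter> K)\<close>, so intersecting them with \<open>K\<close> and
  closing again leads to no point outside that set.
\<close>

lemma kuratowski_Un_closure_of_Int:
  "kuratowski_closure_operator (topspace \<T>) (\<lambda>A. A \<union> \<T> closure_of (A \<inter> K))"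
proof -
  have "\<T> closure_of ((A \<union> \<T> closure_of (A \<inter> K)) \<inter> K) \<subseteq> \<T> closure_of (A \<inter> K)" for A
  proof -
    have "\<T> closure_of (\<T> closure_of (A \<inter> K) \<inter> K) \<subseteq> \<T> closure_of (A \<inter> K)"
      by (rule closure_of_minimal) auto
    then show ?thesis
      by (simp add: Int_Un_distrib2)
  qed
  then have "(A \<union> \<T> closure_of (A \<inter> K)) \<union> \<T> closure_of ((A \<union> \<T> closure_of (A \<inter> K)) \<inter> K)
      = A \<union> \<T> closure_of (A \<inter> K)" for A
    by blast
  moreover have "\<T> closure_of ((A \<union> B) \<inter> K) = \<T> closure_of (A \<inter> K) \<union> \<T> closure_of (B \<inter> K)" for A B
    by (simp add: Int_Un_distrib2)
  then have "A \<union> B \<union> \<T> closure_of ((A \<union> B) \<inter> K)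
      = (A \<union> \<T> closure_of (A \<inter> K)) \<union> (B \<union> \<T> closure_of (B \<inter> K))" for A B
    by blast
  moreover have "(\<lambda>A. A \<union> \<T> closure_of (A \<inter> K)) \<in> Pow (topspace \<T>) \<rightarrow> Pow (topspace \<T>)"
    by (intro Pi_I) (simp add: closure_of_subset_topspace)
  ultimately show ?thesis
    unfolding kuratowski_closure_operator_def by simp
qed

theorem corollary6p8:
  fixes \<T> :: "'a topology" and \<I> :: "'a set set"
  assumes "ideal_topological_space \<T> \<I>"
  shows "kuratowski_closure_operator (topspace \<T>) (cl_sharp \<T> \<I>)"
proof -
  have "cl_sharp \<T> \<I> = (\<lambda>A. A \<union> \<T> closure_of (A \<inter> \<Union>\<I>))"
    using assms unfolding ideal_topological_space_def
    by (simp add: fun_eq_iff cl_sharp_def sharp_eq_closure_of)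
  then show ?thesis
    by (simp add: kuratowski_Un_closure_of_Int)
qed

end
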